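(* Let $(\mathfrak B,N)$ be a pseudo-Hessian-Nijenhuis structure on a pre-Lie algebra $(\mathfrak g,\cdot_{\mathfrak g})$, and for $k\in\mathbb Z$ let $\mathfrak B_k(x,y)=\mathfrak B(x,N^k(y))$. Then for all $k\in\mathbb Z$, $\mathfrak B_k$ is a pseudo-Hessian structure on $(\mathfrak g,\cdot_{\mathfrak g})$. Furthermore, for all $k,l\in\mathbb Z$, $(\mathfrak B_k,N^l)$ is a pseudo-Hessian-Nijenhuis structure on $(\mathfrak g,\cdot_{\mathfrak g})$.
   Context: $\mathbb K$ is an algebraically closed field of characteristic $0$; vector spaces are finite dimensional over $\mathbb K$. A pre-Lie algebra is a vector space $\mathfrak g$ with a bilinear product $\cdot_{\mathfrak g}$ such that $(x\cdot_{\mathfrak g} y)\cdot_{\mathfrak g} z-x\cdot_{\mathfrak g}(y\cdot_{\mathfrak g} z)$ is symmetric in $x,y$. For a symmetric bilinear form $\mathfrak B$ on $\mathfrak g$, call $\mathfrak B$ closed ($\mathrm d^T\mathfrak B=0$) if $\mathfrak B(x\cdot_{\mathfrak g}y,z)-\mathfrak B(x,y\cdot_{\mathfrak g}z)=\mathfrak B(y\cdot_{\mathfrak g}x,z)-\mathfrak B(y,x\cdot_{\mathfrak g}z)$ for all $x,y,z$. A pseudo-Hessian structure on $(\mathfrak g,\cdot_{\mathfrak g})$ is a symmetric nondegenerate closed bilinear form. A linear map $N:\mathfrak g\to\mathfrak g$ is a Nijenhuis operator if $N(x)\cdot_{\mathfrak g}N(y)=N\big(N(x)\cdot_{\mathfrak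 g}y+x\cdot_{\mathfrak g}N(y)-N(x\cdot_{\mathfrak g}y)\big)$ for all $x,y$. A pseudo-Hessian-Nijenhuis structure is a pair $(\mathfrak B,N)$ with $\mathfrak B$ a pseudo-Hessian structure and $N$ an invertible Nijenhuis operator such that $\mathfrak B(N(x),y)=\mathfrak B(x,N(y))$ for all $x,y$ and the (symmetric) form $\mathfrak B_1(x,y)=\mathfrak B(x,N(y))$ is closed. *)

theory Defs
  imports "HOL-Computational_Algebra.Polynomial"
begin

text \<open>The ground field and the space are types; the space carries an arbitrary scalar
  multiplication, as in \<^theory>\<open>HOL.Vector_Spaces\<close>.\<close>

definition bilinear_map ::
    "('k::field \<Rightarrow> 'g::ab_group_add \<Rightarrow> 'g) \<Rightarrow> ('k \<Rightarrow> 'v::ab_group_add \<Rightarrow> 'v) \<Rightarrow> ('g \<Rightarrow> 'g \<Rightarrow> 'v) \<Rightarrow> bool"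
  where "bilinear_map scale scale' f \<longleftrightarrow>
    (\<forall>x. Vector_Spaces.linear scale scale' (\<lambda>y. f x y)) \<and>
    (\<forall>y. Vector_Spaces.linear scale scale' (\<lambda>x. f x y))"

locale pre_lie_algebra = vector_space scale
  for scale :: "'k::field \<Rightarrow> 'g::ab_group_add \<Rightarrow> 'g" +
  fixes pmult :: "'g \<Rightarrow> 'g \<Rightarrow> 'g"  (infixl \<open>\<cdot>\<close> 70)
  assumes bilinear_pmult: "bilinear_map scale scale pmult"
    and associator_left_symmetric:
      "(x \<cdot> y) \<cdot> z - x \<cdot> (y \<cdot> z) = (y \<cdot> x) \<cdot> z - y \<cdot> (x \<cdot> z)"

definition symmetric_form :: "('g \<Rightarrow> 'g \<Rightarrow> 'k) \<Rightarrow> bool"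
  where "symmetric_form B \<longleftrightarrow> (\<forall>x y. B x y = B y x)"

definition nondegenerate_form :: "('g::zero \<Rightarrow> 'g \<Rightarrow> 'k::zero) \<Rightarrow> bool"
  where "nondegenerate_form B \<longleftrightarrow> (\<forall>x. (\<forall>y. B x y = 0) \<longrightarrow> x = 0)"

definition closed_form :: "('g \<Rightarrow> 'g \<Rightarrow> 'g) \<Rightarrow> ('g \<Rightarrow> 'g \<Rightarrow> 'k::ab_group_add) \<Rightarrow> bool"
  where "closed_form pmult B \<longleftrightarrow>
    (\<forall>x y z. B (pmult x y) z - B x (pmult y z) = B (pmult y x) z - B y (pmult x z))"

definition pseudo_hessian ::
    "('k::field \<Rightarrow> 'g::ab_group_add \<Rightarrow> 'g) \<Rightarrow> ('g \<Rightarrow> 'g \<Rightarrow> 'g) \<Rightarrow> ('g \<Rightarrow> 'g \<Rightarrow> 'k) \<Rightarrow> bool"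
  where "pseudo_hessian scale pmult B \<longleftrightarrow>
    bilinear_map scale (*) B \<and> symmetric_form B \<and> nondegenerate_form B \<and> closed_form pmult B"

definition nijenhuis_operator ::
    "('k::field \<Rightarrow> 'g::ab_group_add \<Rightarrow> 'g) \<Rightarrow> ('g \<Rightarrow> 'g \<Rightarrow> 'g) \<Rightarrow> ('g \<Rightarrow> 'g) \<Rightarrow> bool"
  where "nijenhuis_operator scale pmult N \<longleftrightarrow>
    Vector_Spaces.linear scale scale N \<and>
    (\<forall>x y. pmult (N x) (N y) = N (pmult (N x) y + pmult x (N y) - N (pmult x y)))"

definition pseudo_hessian_nijenhuis ::
    "('k::field \<Rightarrow> 'g::ab_group_add \<Rightarrow> 'g) \<Rightarrow> ('g \<Rightarrow> 'g \<Rightarrow> 'g) \<Rightarrow> ('g \<Rightarrow> 'g \<Rightarrow> 'k) \<Rightarrow> ('g \<Rightarrow> 'g) \<Rightarrow> bool"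
  where "pseudo_hessian_nijenhuis scale pmult B N \<longleftrightarrow>
    pseudo_hessian scale pmult B \<and>
    nijenhuis_operator scale pmult N \<and> bij N \<and>
    (\<forall>x y. B (N x) y = B x (N y)) \<and>
    closed_form pmult (\<lambda>x y. B x (N y))"

text \<open>Integer powers of a map; for negative exponents meaningful only if the map is bijective.\<close>

definition int_iterate :: "('g \<Rightarrow> 'g) \<Rightarrow> int \<Rightarrow> 'g \<Rightarrow> 'g"
  where "int_iterate N k = (if 0 \<le> k then N ^^ nat k else inv N ^^ nat (- k))"

end

theory Submission
  imports Defs
begin

text \<open>
  Regard the product \<open>m(x, y) = x \<cdot> y\<close> as a vector on which \<open>N\<close> acts in three commuting ways: on the
  value (call this \<open>a\<close>), on the left argument (\<open>b\<close>) and on the right argument (\<open>c\<close>). The Nijenhuis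
  identity says \<open>(b - a)(c - a) m = 0\<close>. For nonnegative \<open>i\<close> and \<open>j\<close> the product
  \<open>(b\<^sup>i - a\<^sup>i)(c\<^sup>j - a\<^sup>j)\<close> is a multiple of \<open>(b - a)(c - a)\<close>, and the same holds for all integers once
  \<open>a\<close>, \<open>b\<close>, \<open>c\<close> are invertible; hence \<open>N\<^sup>i\<close> and \<open>N\<^sup>j\<close> satisfy the mixed identity, and with \<open>i = j\<close> every
  integer power of \<open>N\<close> is a Nijenhuis operator. Here the factorisation appears as closure under
  composition and inversion of the maps that satisfy the mixed identity, in each of the two
  arguments (\<open>nijenhuis_pair_power\<close>).

  Write \<open>B\<^sub>k(x, y) = B(x, N\<^sup>k y)\<close>. The forms obey a three-term rule, \<open>closed_form_twice\<close>: if \<open>B\<close> and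
  \<open>B\<^sub>1\<close> are closed and \<open>N\<close> is Nijenhuis and self-adjoint, then \<open>B\<^sub>2\<close> is closed. Applied to \<open>B\<^sub>k\<close> and \<open>N\<close>
  it passes from the pair of closed forms \<open>B\<^sub>k\<close>, \<open>B\<^sub>k\<^sub>+\<^sub>1\<close> to \<open>B\<^sub>k\<^sub>+\<^sub>2\<close>; applied to \<open>B\<^sub>k\<^sub>+\<^sub>1\<close> and the inverse of
  \<open>N\<close> it passes to \<open>B\<^sub>k\<^sub>-\<^sub>1\<close>. So all \<open>B\<^sub>k\<close> are closed. Symmetry and
  nondegeneracy hold because \<open>N\<^sup>k\<close> is self-adjoint and bijective, and the compatibility of \<open>B\<^sub>k\<close> with
  \<open>N\<^sup>l\<close> is the closedness of \<open>B\<^sub>k\<^sub>+\<^sub>l\<close>.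
\<close>

section \<open>Integer powers of a bijection\<close>

lemma int_iterate_0: "int_iterate N 0 = id"
  by (simp add: int_iterate_def id_def fun_eq_iff)

lemma int_iterate_1: "int_iterate N 1 = N"
  by (simp add: int_iterate_def fun_eq_iff)

lemma int_iterate_Suc:
  assumes "bij N"
  shows "int_iterate N (k + 1) x = N (int_iterate N k x)"
proof (cases "0 \<le> k")
  case True
  then have "nat (k + 1) = Suc (nat k)" by simp
  with True show ?thesis by (simp add: int_iterate_def)
next
  case False
  define m where "m = nat (- (k + 1))"
  have m: "nat (- k) = Suc m"
    using False by (simp add: m_def)
  have "int_iterate N (k + 1) x = (inv N ^^ m) x"
    using False by (auto simp: int_iterate_def m_def)
  moreover have "int_iterate N k x = inv N ((inv N ^^ m) x)"
    using False m by (simp add: int_iterate_def)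
  ultimately show ?thesis
    using assms by (simp add: bij_is_surj surj_f_inv_f)
qed

lemma int_iterate_pred:
  assumes "bij N"
  shows "int_iterate N (k - 1) x = inv N (int_iterate N k x)"
  using int_iterate_Suc[OF assms, of "k - 1" x] assms
  by (simp add: bij_is_inj inv_f_f)

lemma int_iterate_induct:
  assumes "bij N" and "P id"
    and "\<And>f. P f \<Longrightarrow> P (N \<circ> f)" and "\<And>f. P f \<Longrightarrow> P (inv N \<circ> f)"
  shows "P (int_iterate N k)"
proof (induction k rule: int_induct[of _ 0])
  case base
  show ?case using assms(2) by (simp only: int_iterate_0)
next
  case (step1 i)
  have "int_iterate N (i + 1) = N \<circ> int_iterate N i"
    by (simp add: fun_eq_iff int_iterate_Suc[OF assms(1)])
  then show ?case using assms(3)[OF step1(2)] by (simp only:)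
next
  case (step2 i)
  have "int_iterate N (i - 1) = inv N \<circ> int_iterate N i"
    by (simp add: fun_eq_iff int_iterate_pred[OF assms(1)])
  then show ?case using assms(4)[OF step2(2)] by (simp only:)
qed

lemma int_iterate_add:
  assumes "bij N"
  shows "int_iterate N (k + l) x = int_iterate N k (int_iterate N l x)"
proof (induction k rule: int_induct[of _ 0])
  case base
  show ?case by (simp add: int_iterate_0)
next
  case (step1 i)
  then show ?case
    using int_iterate_Suc[OF assms, of "i + l" x] int_iterate_Suc[OF assms, of i]
    by (simp add: algebra_simps)
next
  case (step2 i)
  then show ?case
    using int_iterate_pred[OF assms, of "i + l" x] int_iterate_pred[OF assms, of i]
    by (simp add: algebra_simps)
qed

lemma int_iterate_commute:
  assumes "bij N"
  shows "int_iterate N k (int_iterate N l x) = int_iterate N l (int_iterate N k x)"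
  by (metis add.commute int_iterate_add[OF assms])

lemma bij_int_iterate: "bij N \<Longrightarrow> bij (int_iterate N k)"
  by (rule int_iterate_induct) (simp_all only: bij_id bij_comp bij_imp_bij_inv)

lemma linear_inv:
  assumes "Vector_Spaces.linear scale scale N" and "bij N"
  shows "Vector_Spaces.linear scale scale (inv N)"
proof -
  interpret N: Vector_Spaces.linear scale scale N by fact
  have cancel: "N (inv N x) = x" "inv N (N x) = x" for x
    using assms(2) by (simp_all add: bij_is_surj surj_f_inv_f bij_is_inj)
  show ?thesis
  proof unfold_locales
    show "inv N (x + y) = inv N x + inv N y" for x y
      by (metis N.add cancel)
    show "inv N (scale r x) = scale r (inv N x)" for r x
      by (metis N.scale cancel)
  qed
qed

lemma linear_int_iterate:
  assumes "Vector_Spaces.linear scale scale N" and "bij N"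
  shows "Vector_Spaces.linear scale scale (int_iterate N k)"
proof (rule int_iterate_induct[OF assms(2)])
  interpret N: Vector_Spaces.linear scale scale N by fact
  show "Vector_Spaces.linear scale scale id"
    unfolding id_def by (rule N.vs1.linear_ident)
qed (rule Vector_Spaces.linear_compose, assumption, intro linear_inv assms)+

section \<open>Integer powers of a Nijenhuis operator\<close>

text \<open>The polarised Nijenhuis identity. With two different maps it behaves multiplicatively in each
  argument separately, which the identity for a single operator does not.\<close>

definition nijenhuis_pair :: "('g \<Rightarrow> 'g \<Rightarrow> 'g::ab_group_add) \<Rightarrow> ('g \<Rightarrow> 'g) \<Rightarrow> ('g \<Rightarrow> 'g) \<Rightarrow> bool"
  where "nijenhuis_pair pmult P Q \<longleftrightarrow>
    (\<forall>x y. pmult (P x) (Q y) + P (Q (pmult x y)) = P (pmult x (Q y)) + Q (pmult (P x) y))"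

lemma nijenhuis_operator_iff_pair:
  "nijenhuis_operator scale pmult N \<longleftrightarrow>
    Vector_Spaces.linear scale scale N \<and> nijenhuis_pair pmult N N"
proof (cases "Vector_Spaces.linear scale scale N")
  case True
  then interpret N: Vector_Spaces.linear scale scale N .
  show ?thesis
    by (simp add: True nijenhuis_operator_def nijenhuis_pair_def N.add N.diff)
      (simp add: algebra_simps)
qed (simp add: nijenhuis_operator_def)

lemma nijenhuis_pairD:
  assumes "nijenhuis_pair pmult P Q"
  shows "pmult (P x) (Q y) = P (pmult x (Q y)) + Q (pmult (P x) y) - P (Q (pmult x y))"
  using assms by (simp add: nijenhuis_pair_def eq_diff_eq)

text \<open>In the operator language this is
  \<open>bb' - aa' = (b - a) b' + a (b' - a')\<close>, multiplied by the factor that belongs to \<open>Q\<close>.\<close>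

lemma nijenhuis_pair_comp_left:
  assumes "Vector_Spaces.linear scale scale P"
    and "nijenhuis_pair pmult P Q" and "nijenhuis_pair pmult P' Q"
  shows "nijenhuis_pair pmult (P \<circ> P') Q"
proof -
  interpret P: Vector_Spaces.linear scale scale P by fact
  show ?thesis
    unfolding nijenhuis_pair_def o_def
    by (simp add: nijenhuis_pairD[OF assms(2), of "P' _"] nijenhuis_pairD[OF assms(3)]
        P.add P.diff)
qed

text \<open>Here \<open>b\<^sup>-\<^sup>1 - a\<^sup>-\<^sup>1 = - a\<^sup>-\<^sup>1 b\<^sup>-\<^sup>1 (b - a)\<close>: substitute the preimage of \<open>x\<close> and apply the inverse to
  the identity.\<close>

lemma nijenhuis_pair_inv_left:
  assumes "Vector_Spaces.linear scale scale P" and "bij P"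
    and comm: "\<And>x. P (Q x) = Q (P x)"
    and "nijenhuis_pair pmult P Q"
  shows "nijenhuis_pair pmult (inv P) Q"
proof -
  interpret I: Vector_Spaces.linear scale scale "inv P"
    using assms(1,2) by (rule linear_inv)
  have cancel: "P (inv P x) = x" "inv P (P x) = x" for x
    using assms(2) by (simp_all add: bij_is_surj surj_f_inv_f bij_is_inj)
  have comm': "inv P (Q x) = Q (inv P x)" for x
    by (metis cancel comm)
  show ?thesis
    unfolding nijenhuis_pair_def
  proof (intro allI)
    fix x y
    have "pmult x (Q y) + P (Q (pmult (inv P x) y)) = P (pmult (inv P x) (Q y)) + Q (pmult x y)"
      using assms(4)[unfolded nijenhuis_pair_def, rule_format, of "inv P x" y]
      by (simp add: cancel)
    then have "inv P (pmult x (Q y) + P (Q (pmult (inv P x) y))) =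
        inv P (P (pmult (inv P x) (Q y)) + Q (pmult x y))"
      by simp
    then show "pmult (inv P x) (Q y) + inv P (Q (pmult x y)) =
        inv P (pmult x (Q y)) + Q (pmult (inv P x) y)"
      by (simp add: I.add cancel)
  qed
qed

text \<open>Passing to the opposite product exchanges the two arguments, so the right-hand versions of the
  closure properties come for free.\<close>

lemma nijenhuis_pair_opposite:
  assumes "\<And>x. P (Q x) = Q (P x)"
  shows "nijenhuis_pair (\<lambda>x y. pmult y x) P Q \<longleftrightarrow> nijenhuis_pair pmult Q P"
proof -
  have "pmult (Q y) (P x) + P (Q (pmult y x)) = P (pmult (Q y) x) + Q (pmult y (P x)) \<longleftrightarrow>
      pmult (Q y) (P x) + Q (P (pmult y x)) = Q (pmult y (P x)) + P (pmult (Q y) x)" for x y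
    by (simp only: assms add.commute)
  then show ?thesis
    unfolding nijenhuis_pair_def by blast
qed

lemma nijenhuis_pair_power_left:
  assumes lin: "Vector_Spaces.linear scale scale N" and bij: "bij N"
    and comm: "\<And>x. N (Q x) = Q (N x)"
    and pair: "nijenhuis_pair pmult N Q"
  shows "nijenhuis_pair pmult (int_iterate N k) Q"
proof (rule int_iterate_induct[OF bij])
  show "nijenhuis_pair pmult id Q"
    by (simp add: nijenhuis_pair_def)
next
  fix f
  assume f: "nijenhuis_pair pmult f Q"
  show "nijenhuis_pair pmult (N \<circ> f) Q"
    by (rule nijenhuis_pair_comp_left[OF lin pair f])
  have "nijenhuis_pair pmult (inv N) Q"
    using lin bij comm pair by (rule nijenhuis_pair_inv_left)
  then show "nijenhuis_pair pmult (inv N \<circ> f) Q"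
    by (rule nijenhuis_pair_comp_left[OF linear_inv[OF lin bij] _ f])
qed

lemma nijenhuis_pair_power:
  assumes lin: "Vector_Spaces.linear scale scale N" and bij: "bij N"
    and pair: "nijenhuis_pair pmult N N"
  shows "nijenhuis_pair pmult (int_iterate N k) (int_iterate N l)"
proof -
  have comm: "N (int_iterate N k x) = int_iterate N k (N x)" for x
    using int_iterate_commute[OF bij, of 1 k x] by (simp add: int_iterate_1)
  have "nijenhuis_pair pmult (int_iterate N k) N"
    by (rule nijenhuis_pair_power_left[OF lin bij refl pair])
  then have "nijenhuis_pair (\<lambda>x y. pmult y x) N (int_iterate N k)"
    using nijenhuis_pair_opposite[of N "int_iterate N k" pmult] comm by blast
  then have "nijenhuis_pair (\<lambda>x y. pmult y x) (int_iterate N l) (int_iterate N k)"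
    using lin bij comm by (intro nijenhuis_pair_power_left)
  then show ?thesis
    using nijenhuis_pair_opposite[of "int_iterate N l" "int_iterate N k" pmult]
      int_iterate_commute[OF bij] by blast
qed

lemma nijenhuis_operator_int_iterate:
  assumes "nijenhuis_operator scale pmult N" and "bij N"
  shows "nijenhuis_operator scale pmult (int_iterate N k)"
  using assms linear_int_iterate[of scale N k] nijenhuis_pair_power[of scale N pmult k k]
  by (simp add: nijenhuis_operator_iff_pair)

section \<open>Closedness of the shifted forms\<close>

text \<open>Write \<open>[x, y] = x \<cdot> y - y \<cdot> x\<close>, so that closedness of \<open>B\<close> reads
  \<open>B([x, y], z) = B(x, y \<cdot> z) - B(y, x \<cdot> z)\<close>. The Nijenhuis identity gives
  \<open>N\<^sup>2 [x, y] = N [N x, y] + N [x, N y] - [N x, N y]\<close>. Pair this with \<open>z\<close>, use closedness of \<open>B\<^sub>1\<close> on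
  the first two terms and of \<open>B\<close> on the last: the terms containing \<open>N x \<cdot> z\<close> or \<open>N y \<cdot> z\<close> cancel
  by self-adjointness, and what is left is closedness of \<open>B\<^sub>2\<close>.\<close>

lemma closed_form_twice:
  fixes B :: "'g::ab_group_add \<Rightarrow> 'g \<Rightarrow> 'k::field"
  assumes "bilinear_map scale (*) B"
    and "nijenhuis_operator scale pmult N"
    and adj: "\<And>x y. B (N x) y = B x (N y)"
    and "closed_form pmult B"
    and "closed_form pmult (\<lambda>x y. B x (N y))"
  shows "closed_form pmult (\<lambda>x y. B x (N (N y)))"
proof -
  have lin: "Vector_Spaces.linear scale (*) (\<lambda>x. B x y)" for y
    using assms(1) by (simp add: bilinear_map_def)
  have B_add: "B (u + v) w = B u w + B v w" and B_diff: "B (u - v) w = B u w - B v w" for u v w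
  proof -
    interpret Vector_Spaces.linear scale "(*)" "\<lambda>x. B x w" by (rule lin)
    show "B (u + v) w = B u w + B v w" by (rule add)
    show "B (u - v) w = B u w - B v w" by (rule diff)
  qed
  have pair: "nijenhuis_pair pmult N N"
    using assms(2) by (simp add: nijenhuis_operator_iff_pair)
  have square: "B (pmult x y) (N (N z)) =
      B (pmult x (N y)) (N z) + B (pmult (N x) y) (N z) - B (pmult (N x) (N y)) z" for x y z
    using arg_cong[OF nijenhuis_pairD[OF pair, of x y], of "\<lambda>u. B u z"]
    by (simp add: B_add B_diff adj)
  have c0: "B (pmult x y) z - B x (pmult y z) = B (pmult y x) z - B y (pmult x z)" for x y z
    using assms(4) unfolding closed_form_def by blast
  have c1: "B (pmult x y) (N z) - B x (N (pmult y z)) = B (pmult y x) (N z) - B y (N (pmult x z))"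
    for x y z
    using assms(5) unfolding closed_form_def by blast
  show ?thesis
    unfolding closed_form_def
  proof (intro allI)
    fix x y z
    show "B (pmult x y) (N (N z)) - B x (N (N (pmult y z))) =
        B (pmult y x) (N (N z)) - B y (N (N (pmult x z)))"
      using c0[of "N x" "N y" z] c1[of "N x" y z] c1[of x "N y" z]
      by (simp add: square adj) algebra
  qed
qed

lemma self_adjoint_int_iterate:
  assumes bij: "bij N" and adj: "\<And>x y. B (N x) y = B x (N y)"
  shows "B (int_iterate N k x) y = B x (int_iterate N k y)"
proof -
  have cancel: "N (inv N x) = x" "inv N (N x) = x" for x
    using bij by (simp_all add: bij_is_surj surj_f_inv_f bij_is_inj)
  have adj': "B (inv N x) y = B x (inv N y)" for x y
    using adj[of "inv N x" "inv N y"] by (simp add: cancel)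
  \<comment> \<open>A composite of self-adjoint maps is self-adjoint when they commute, so the induction has to
    carry commutation with \<open>N\<close> along.\<close>
  have "\<forall>x y. B (int_iterate N k x) y = B x (int_iterate N k y) \<and>
      int_iterate N k (N x) = N (int_iterate N k x)"
  proof (rule int_iterate_induct[OF bij])
    fix f
    assume f: "\<forall>x y. B (f x) y = B x (f y) \<and> f (N x) = N (f x)"
    then have "f (inv N x) = inv N (f x)" for x
      by (metis cancel)
    with f show "\<forall>x y. B ((inv N \<circ> f) x) y = B x ((inv N \<circ> f) y) \<and>
        (inv N \<circ> f) (N x) = N ((inv N \<circ> f) x)"
      by (simp add: adj' cancel)
  qed (simp_all add: adj)
  then show ?thesis by blast
qed

lemma bilinear_map_int_iterate:
  assumes "bilinear_map scale scale' B" and "Vector_Spaces.linear scale scale N" and "bij N"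
  shows "bilinear_map scale scale' (\<lambda>x y. B x (int_iterate N k y))"
  unfolding bilinear_map_def
proof (intro conjI allI)
  fix x
  have "Vector_Spaces.linear scale scale' (B x \<circ> int_iterate N k)"
    using linear_int_iterate[OF assms(2,3)] assms(1)
    unfolding bilinear_map_def by (blast intro: Vector_Spaces.linear_compose)
  then show "Vector_Spaces.linear scale scale' (\<lambda>y. B x (int_iterate N k y))"
    by (simp add: o_def)
qed (use assms(1) in \<open>simp add: bilinear_map_def\<close>)

lemma closed_form_int_iterate:
  fixes B :: "'g::ab_group_add \<Rightarrow> 'g \<Rightarrow> 'k::field"
  assumes bil: "bilinear_map scale (*) B"
    and nij: "nijenhuis_operator scale pmult N" and bij: "bij N"
    and adj: "\<And>x y. B (N x) y = B x (N y)"
    and "closed_form pmult B" and "closed_form pmult (\<lambda>x y. B x (N y))"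
  shows "closed_form pmult (\<lambda>x y. B x (int_iterate N k y))"
proof -
  let ?B = "\<lambda>k x y. B x (int_iterate N k y)"
  have bil_k: "bilinear_map scale (*) (?B k)" for k
    using nij by (intro bilinear_map_int_iterate bil bij) (simp add: nijenhuis_operator_def)
  have adj_k: "?B k (int_iterate N l x) y = ?B k x (int_iterate N l y)" for k l x y
    by (simp add: self_adjoint_int_iterate[of N B, OF bij adj] int_iterate_commute[OF bij, of l])
  \<comment> \<open>Taking the power \<open>d\<close> to be \<open>1\<close> or \<open>- 1\<close> extends a pair of neighbours upwards or downwards.\<close>
  have extend: "closed_form pmult (?B (k + (d + d)))"
    if "closed_form pmult (?B k)" "closed_form pmult (?B (k + d))" for k d
  proof -
    have "closed_form pmult (\<lambda>x y. ?B k x (int_iterate N d y))"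
      using that(2) by (simp add: int_iterate_add[OF bij])
    from closed_form_twice[OF bil_k nijenhuis_operator_int_iterate[OF nij bij] adj_k that(1) this]
    show ?thesis
      by (simp only: int_iterate_add[OF bij])
  qed
  have "closed_form pmult (?B k) \<and> closed_form pmult (?B (k + 1))"
  proof (induction k rule: int_induct[of _ 0])
    case base
    show ?case using assms(5,6) by (simp add: int_iterate_0 int_iterate_1)
  next
    case (step1 i)
    then show ?case using extend[of i 1] by (simp add: add.assoc)
  next
    case (step2 i)
    then show ?case using extend[of "i + 1" "- 1"] by simp
  qed
  then show ?thesis ..
qed

section \<open>The hierarchy of pseudo-Hessian-Nijenhuis structures\<close>

lemma pseudo_hessian_int_iterate:
  assumes "pseudo_hessian_nijenhuis scale pmult B N"
  shows "pseudo_hessian scale pmult (\<lambda>x y. B x (int_iterate N k y))"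
proof -
  have bil: "bilinear_map scale (*) B" and sym: "\<And>x y. B x y = B y x"
    and nondeg: "nondegenerate_form B" and closed: "closed_form pmult B"
    and nij: "nijenhuis_operator scale pmult N" and bij: "bij N"
    and adj: "\<And>x y. B (N x) y = B x (N y)" and closed1: "closed_form pmult (\<lambda>x y. B x (N y))"
    using assms
    by (auto simp: pseudo_hessian_nijenhuis_def pseudo_hessian_def symmetric_form_def)
  have "symmetric_form (\<lambda>x y. B x (int_iterate N k y))"
    unfolding symmetric_form_def by (metis self_adjoint_int_iterate[of N B, OF bij adj] sym)
  moreover have "nondegenerate_form (\<lambda>x y. B x (int_iterate N k y))"
    using nondeg bij_is_surj[OF bij_int_iterate[OF bij, of k]]
    unfolding nondegenerate_form_def by (metis surjD)
  moreover have "bilinear_map scale (*) (\<lambda>x y. B x (int_iterate N k y))"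
    using nij by (intro bilinear_map_int_iterate bil bij) (simp add: nijenhuis_operator_def)
  ultimately show ?thesis
    using closed_form_int_iterate[OF bil nij bij adj closed closed1]
    by (simp add: pseudo_hessian_def)
qed

theorem theorem6p6:
  fixes scale :: "'k::{alg_closed_field, field_char_0} \<Rightarrow> 'g::ab_group_add \<Rightarrow> 'g"
    and Basis :: "'g set"
    and pmult :: "'g \<Rightarrow> 'g \<Rightarrow> 'g"
    and B :: "'g \<Rightarrow> 'g \<Rightarrow> 'k"
    and N :: "'g \<Rightarrow> 'g"
  assumes "finite_dimensional_vector_space scale Basis"
    and "pre_lie_algebra scale pmult"
    and "pseudo_hessian_nijenhuis scale pmult B N"
  shows "(\<forall>k::int. pseudo_hessian scale pmult (\<lambda>x y. B x (int_iterate N k y))) \<and>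
    (\<forall>k l::int. pseudo_hessian_nijenhuis scale pmult
        (\<lambda>x y. B x (int_iterate N k y)) (int_iterate N l))"
proof (intro conjI allI)
  have nij: "nijenhuis_operator scale pmult N" and bij: "bij N"
    and adj: "\<And>x y. B (N x) y = B x (N y)"
    using assms(3) by (simp_all add: pseudo_hessian_nijenhuis_def)
  note hessian = pseudo_hessian_int_iterate[OF assms(3)]
  show "pseudo_hessian scale pmult (\<lambda>x y. B x (int_iterate N k y))" for k
    by (rule hessian)
  show "pseudo_hessian_nijenhuis scale pmult (\<lambda>x y. B x (int_iterate N k y)) (int_iterate N l)"
    for k l
    unfolding pseudo_hessian_nijenhuis_def
  proof (intro conjI allI)
    show "B (int_iterate N l x) (int_iterate N k y) = B x (int_iterate N k (int_iterate N l y))"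
      for x y
      by (simp add: self_adjoint_int_iterate[of N B, OF bij adj] int_iterate_commute[OF bij, of l])
    show "closed_form pmult (\<lambda>x y. B x (int_iterate N k (int_iterate N l y)))"
      using hessian[of "k + l"] by (simp add: pseudo_hessian_def int_iterate_add[OF bij])
  qed (intro hessian nijenhuis_operator_int_iterate bij_int_iterate nij bij)+
qed

end
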